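(* For every integer $r\geq 1$, there exists a connected graph $G$ with an edge $e$ such that deleting $e$ preserves connectivity and increases the gonality of $G$ by exactly $r$: $\operatorname{gon}(G-e)=\operatorname{gon}(G)+r$.
   Context: Graphs are finite, connected, undirected, loopless multigraphs. $\operatorname{gon}(G)$ denotes the divisorial gonality of $G$, i.e. the minimum degree of a divisor of positive rank in the chip-firing (Baker–Norine) divisor theory on $G$. *)

theory Defs
  imports Main "HOL-Library.Multiset"
begin

text \<open>
  An edge is a two-element vertex set; parallel edges are recorded by the multiplicities in
  the edge multiset, so that two vertices u and v are joined by count (mg_edges G) {u, v} edges.
\<close>

record 'v mgraph =
  mg_verts :: "'v set"
  mg_edges :: "'v set multiset"

definition multigraph :: "'v mgraph \<Rightarrow> bool" where
  "multigraph G \<longleftrightarrow>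
     finite (mg_verts G) \<and> mg_verts G \<noteq> {} \<and>
     (\<forall>e \<in># mg_edges G. e \<subseteq> mg_verts G \<and> card e = 2)"

definition mg_adj :: "'v mgraph \<Rightarrow> 'v \<Rightarrow> 'v \<Rightarrow> bool" where
  "mg_adj G u v \<longleftrightarrow> {u, v} \<in># mg_edges G"

definition mg_connected :: "'v mgraph \<Rightarrow> bool" where
  "mg_connected G \<longleftrightarrow> (\<forall>u \<in> mg_verts G. \<forall>v \<in> mg_verts G. (mg_adj G)\<^sup>*\<^sup>* u v)"

text \<open>Exactly one copy of a multiple edge is removed.\<close>

definition mg_delete_edge :: "'v mgraph \<Rightarrow> 'v set \<Rightarrow> 'v mgraph" where
  "mg_delete_edge G e = G\<lparr>mg_edges := mg_edges G - {#e#}\<rparr>"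

text \<open>
  A divisor is an integer-valued function on the vertices. It is represented by a total function
  whose values outside the vertex set are irrelevant: every notion below only depends on the
  restriction to the vertex set.
\<close>

type_synonym 'v divisor = "'v \<Rightarrow> int"

definition div_degree :: "'v mgraph \<Rightarrow> 'v divisor \<Rightarrow> int" where
  "div_degree G D = (\<Sum>v \<in> mg_verts G. D v)"

definition div_effective :: "'v mgraph \<Rightarrow> 'v divisor \<Rightarrow> bool" where
  "div_effective G D \<longleftrightarrow> (\<forall>v \<in> mg_verts G. 0 \<le> D v)"

definition mg_laplacian :: "'v mgraph \<Rightarrow> ('v \<Rightarrow> int) \<Rightarrow> 'v divisor" where
  "mg_laplacian G f v = (\<Sum>u \<in> mg_verts G. int (count (mg_edges G) {u, v}) * (f v - f u))"

definition div_equiv :: "'v mgraph \<Rightarrow> 'v divisor \<Rightarrow> 'v divisor \<Rightarrow> bool" where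
  "div_equiv G D D' \<longleftrightarrow> (\<exists>f. \<forall>v \<in> mg_verts G. D' v = D v - mg_laplacian G f v)"

definition equiv_effective :: "'v mgraph \<Rightarrow> 'v divisor \<Rightarrow> bool" where
  "equiv_effective G D \<longleftrightarrow> (\<exists>D'. div_equiv G D D' \<and> div_effective G D')"

text \<open>
  The Baker--Norine rank. The set of admissible k contains 0 in the second case and is bounded
  by the degree of D, as equivalent divisors have the same degree; so the maximum exists.
\<close>

definition div_rank :: "'v mgraph \<Rightarrow> 'v divisor \<Rightarrow> int" where
  "div_rank G D =
     (if \<not> equiv_effective G D then - 1
      else int (GREATEST k :: nat. \<forall>E. div_effective G E \<and> div_degree G E = int k
                   \<longrightarrow> equiv_effective G (\<lambda>v. D v - E v)))"

text \<open>
  A divisor of positive rank is equivalent to an effective one, so its degree is a natural number;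
  placing one chip on every vertex gives a divisor of positive rank, so the minimum exists.
\<close>

definition gonality :: "'v mgraph \<Rightarrow> nat" where
  "gonality G = (LEAST d :: nat. \<exists>D. div_degree G D = int d \<and> div_rank G D > 0)"

end

theory Submission
  imports Defs
begin

text \<open>
  Two vertices joined by more edges than the degree of an effective divisor are fired equally often
  on the way to any other effective divisor. Take two sets of r + 1 vertices, each tied together by
  such heavy edges, and join one vertex of the first set to one of the second by a long path; join
  the r other vertices of each set to an additional vertex, the centre of a star. Let e be an edge
  between the two centres. As the heavy edges carry no chips, the path has a constant number of
  chips, which is at least 1, and so have the two stars together, where r chips are needed to occupy
  all leaves of one star. These r + 1 chips suffice: they traverse the graph level by level, r of
  them crossing e one at a time while the last one walks along the path. Without e each star
  needs r chips of its own, and the gonality becomes 2 r + 1.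
\<close>

section \<open>The Laplacian and linear equivalence\<close>

lemma sum_antisym_zero:
  fixes h :: "'a \<Rightarrow> 'a \<Rightarrow> int"
  assumes "\<And>u v. h u v = - h v u"
  shows "(\<Sum>v\<in>A. \<Sum>u\<in>A. h u v) = 0"
proof -
  have "(\<Sum>v\<in>A. \<Sum>u\<in>A. h u v) = (\<Sum>v\<in>A. \<Sum>u\<in>A. h v u)"
    by (rule sum.swap)
  also have "\<dots> = - (\<Sum>v\<in>A. \<Sum>u\<in>A. h u v)"
    by (subst assms) (simp add: sum_negf)
  finally show ?thesis by simp
qed

text \<open>Chips moved along edges inside \<open>A\<close> cancel in pairs. For the whole vertex
  set this is conservation of degree; for a smaller \<open>A\<close> it leaves only the boundary
  edges to be counted.\<close>

lemma sum_laplacian_inside_zero: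
  "(\<Sum>v\<in>A. \<Sum>u\<in>A. int (count (mg_edges G) {u, v}) * (f v - f u)) = 0"
  by (rule sum_antisym_zero) (simp add: insert_commute algebra_simps)

lemma sum_laplacian_zero: "(\<Sum>v\<in>mg_verts G. mg_laplacian G f v) = 0"
  unfolding mg_laplacian_def by (rule sum_laplacian_inside_zero)

lemma mg_laplacian_diff:
  "mg_laplacian G (\<lambda>x. f x - g x) v = mg_laplacian G f v - mg_laplacian G g v"
  by (simp add: mg_laplacian_def sum_subtractf[symmetric] algebra_simps)

lemma equiv_effective_iff:
  "equiv_effective G D \<longleftrightarrow> (\<exists>f. div_effective G (\<lambda>v. D v - mg_laplacian G f v))"
  unfolding equiv_effective_def div_equiv_def div_effective_def by fastforce

lemma equiv_effective_mono:
  assumes "equiv_effective G D" "\<And>v. v \<in> mg_verts G \<Longrightarrow> D v \<le> D' v"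
  shows "equiv_effective G D'"
proof -
  obtain f where f: "\<And>v. v \<in> mg_verts G \<Longrightarrow> 0 \<le> D v - mg_laplacian G f v"
    using assms(1) unfolding equiv_effective_iff div_effective_def by blast
  have "0 \<le> D' v - mg_laplacian G f v" if "v \<in> mg_verts G" for v
    using f[OF that] assms(2)[OF that] by linarith
  then show ?thesis unfolding equiv_effective_iff div_effective_def by blast
qed

lemma equiv_effective_degree_nonneg:
  assumes "equiv_effective G D"
  shows "0 \<le> div_degree G D"
proof -
  obtain f where "div_effective G (\<lambda>v. D v - mg_laplacian G f v)"
    using assms equiv_effective_iff by blast
  then have "0 \<le> (\<Sum>v\<in>mg_verts G. D v - mg_laplacian G f v)"
    unfolding div_effective_def by (simp add: sum_nonneg)
  then show ?thesis
    by (simp add: div_degree_def sum_subtractf sum_laplacian_zero)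
qed

section \<open>Positive rank and gonality\<close>

text \<open>An effective divisor of degree 1 is a single chip, so rank at least 1 means that a chip
  can be brought to each vertex. Once \<open>D\<close> is equivalent to an effective divisor, the
  \<open>GREATEST\<close> in the rank is attained: \<open>S\<close> holds at 0 and is bounded by the
  degree. As \<open>S\<close> is closed downwards, only \<open>S 1\<close> matters.\<close>

lemma div_rank_pos_iff:
  assumes G: "multigraph G"
  shows "0 < div_rank G D \<longleftrightarrow>
    (\<forall>v\<in>mg_verts G. \<exists>f. div_effective G (\<lambda>w. D w - mg_laplacian G f w) \<and>
       1 \<le> D v - mg_laplacian G f v)" (is "_ \<longleftrightarrow> ?R")
proof -
  let ?V = "mg_verts G"
  define S where "S k \<longleftrightarrow> (\<forall>E. div_effective G E \<and> div_degree G E = int k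
    \<longrightarrow> equiv_effective G (\<lambda>v. D v - E v))" for k
  have rank: "div_rank G D = (if \<not> equiv_effective G D then - 1 else int (GREATEST k. S k))"
    by (simp add: div_rank_def S_def)
  have fin: "finite ?V" using G by (simp add: multigraph_def)
  obtain w where w: "w \<in> ?V" using G by (auto simp: multigraph_def)
  have deg_at: "div_degree G (\<lambda>v. if v = x then c else 0) = c" if "x \<in> ?V" for x c
    using that fin by (simp add: div_degree_def)
  \<comment> \<open>Removing \<open>k\<close> chips at \<open>w\<close> must leave a divisor of
    nonnegative degree.\<close>
  have bound: "k \<le> nat (div_degree G D)" if "S k" for k
  proof -
    have "equiv_effective G (\<lambda>v. D v - (if v = w then int k else 0))"
      using that deg_at[OF w, of "int k"] unfolding S_def div_effective_def by auto
    from equiv_effective_degree_nonneg[OF this] deg_at[OF w, of "int k"]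
    show ?thesis by (simp add: div_degree_def sum_subtractf)
  qed
  have down: "S j" if "S k" "j \<le> k" for j k
    unfolding S_def
  proof (intro allI impI, elim conjE)
    fix E assume E: "div_effective G E" "div_degree G E = int j"
    \<comment> \<open>Padding \<open>E\<close> with \<open>k - j\<close> chips at \<open>w\<close>
      gives a test divisor of degree \<open>k\<close>.\<close>
    let ?F = "\<lambda>v. E v + (if v = w then int (k - j) else 0)"
    have "div_effective G ?F" using E by (simp add: div_effective_def)
    moreover have "div_degree G ?F = int k"
      using E deg_at[OF w, of "int (k - j)"] that by (simp add: div_degree_def sum.distrib)
    ultimately have "equiv_effective G (\<lambda>v. D v - ?F v)"
      using that unfolding S_def by blast
    then show "equiv_effective G (\<lambda>v. D v - E v)"
      by (rule equiv_effective_mono) simp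
  qed
  have S0: "S 0" if "equiv_effective G D"
    unfolding S_def
  proof (intro allI impI, elim conjE)
    fix E assume "div_effective G E" "div_degree G E = int 0"
    then have "\<forall>v\<in>?V. E v = 0"
      using fin by (simp add: div_effective_def div_degree_def sum_nonneg_eq_0_iff)
    then show "equiv_effective G (\<lambda>v. D v - E v)"
      using that by (auto intro: equiv_effective_mono)
  qed
  have "0 < div_rank G D \<longleftrightarrow> S 1"
  proof
    assume "0 < div_rank G D"
    then have "equiv_effective G D" and "1 \<le> (GREATEST k. S k)"
      by (auto simp: rank split: if_splits)
    moreover from this have "S (GREATEST k. S k)"
      using GreatestI_nat[of S 0 "nat (div_degree G D)"] S0 bound by blast
    ultimately show "S 1" using down by blast
  next
    assume 1: "S 1"
    have "equiv_effective G D"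
    proof (rule equiv_effective_mono)
      show "equiv_effective G (\<lambda>v. D v - (if v = w then 1 else 0))"
        using 1 deg_at[OF w, of 1] unfolding S_def div_effective_def by auto
    qed simp
    moreover have "1 \<le> (GREATEST k. S k)"
      using Greatest_le_nat[of S 1 "nat (div_degree G D)"] 1 bound by blast
    ultimately show "0 < div_rank G D" by (simp add: rank)
  qed
  also have "S 1 \<longleftrightarrow> ?R"
  proof
    assume 1: "S 1"
    show ?R
    proof
      fix v assume v: "v \<in> ?V"
      have "equiv_effective G (\<lambda>x. D x - (if x = v then 1 else 0))"
        using 1 deg_at[OF v, of 1] unfolding S_def div_effective_def by auto
      then obtain f where f: "\<And>x. x \<in> ?V \<Longrightarrow> 0 \<le> D x - (if x = v then 1 else 0) - mg_laplacian G f x"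
        unfolding equiv_effective_iff div_effective_def by blast
      have "0 \<le> D x - mg_laplacian G f x" if "x \<in> ?V" for x
        using f[OF that] by (auto split: if_splits)
      moreover have "1 \<le> D v - mg_laplacian G f v" using f[OF v] by simp
      ultimately show "\<exists>f. div_effective G (\<lambda>w. D w - mg_laplacian G f w) \<and>
          1 \<le> D v - mg_laplacian G f v"
        unfolding div_effective_def by blast
    qed
  next
    assume R: ?R
    show "S 1"
      unfolding S_def
    proof (intro allI impI, elim conjE)
      fix E assume E: "div_effective G E" "div_degree G E = int 1"
      then have nonneg: "\<And>x. x \<in> ?V \<Longrightarrow> 0 \<le> E x" by (simp add: div_effective_def)
      have "\<exists>v\<in>?V. E v \<noteq> 0"
        using E unfolding div_degree_def by (metis of_nat_1 sum.neutral zero_neq_one)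
      then obtain v where v: "v \<in> ?V" "1 \<le> E v" using nonneg by fastforce
      have "E v + (\<Sum>x\<in>?V - {v}. E x) = 1"
        using E v fin by (simp add: div_degree_def sum.remove)
      moreover have "0 \<le> (\<Sum>x\<in>?V - {v}. E x)" by (rule sum_nonneg) (use nonneg in auto)
      ultimately have Ev: "E v = 1" and "(\<Sum>x\<in>?V - {v}. E x) = 0" using v by linarith+
      then have E0: "\<forall>x\<in>?V - {v}. E x = 0"
        using nonneg fin sum_nonneg_eq_0_iff[of "?V - {v}" E] by auto
      obtain f where f: "div_effective G (\<lambda>w. D w - mg_laplacian G f w)"
        "1 \<le> D v - mg_laplacian G f v" using R v by blast
      have "div_effective G (\<lambda>x. D x - E x - mg_laplacian G f x)"
        unfolding div_effective_def
      proof
        fix x assume "x \<in> ?V"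
        then show "0 \<le> D x - E x - mg_laplacian G f x"
          using f Ev E0 by (cases "x = v") (auto simp: div_effective_def)
      qed
      then show "equiv_effective G (\<lambda>v. D v - E v)"
        unfolding equiv_effective_iff by blast
    qed
  qed
  finally show ?thesis .
qed

text \<open>The script for any one vertex already leads to an effective divisor; the scripts for the
  other vertices are corrected by subtracting it.\<close>

lemma div_rank_pos_effective_representative:
  assumes G: "multigraph G" and "0 < div_rank G D"
  obtains D' where "div_effective G D'" "div_degree G D' = div_degree G D" "0 < div_rank G D'"
proof -
  have R: "\<forall>v\<in>mg_verts G. \<exists>f. div_effective G (\<lambda>w. D w - mg_laplacian G f w) \<and>
       1 \<le> D v - mg_laplacian G f v"
    using assms div_rank_pos_iff by blast
  obtain w where "w \<in> mg_verts G" using G by (auto simp: multigraph_def)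
  with R obtain g where g: "div_effective G (\<lambda>w. D w - mg_laplacian G g w)" by blast
  let ?D = "\<lambda>w. D w - mg_laplacian G g w"
  have "\<exists>f. div_effective G (\<lambda>w. ?D w - mg_laplacian G f w) \<and> 1 \<le> ?D v - mg_laplacian G f v"
    if v: "v \<in> mg_verts G" for v
  proof -
    obtain f where "div_effective G (\<lambda>w. D w - mg_laplacian G f w)"
       "1 \<le> D v - mg_laplacian G f v" using R v by blast
    then show ?thesis
      by (intro exI[of _ "\<lambda>x. f x - g x"]) (simp add: mg_laplacian_diff)
  qed
  then have "0 < div_rank G ?D" using div_rank_pos_iff[OF G] by blast
  moreover have "div_degree G ?D = div_degree G D"
    by (simp add: div_degree_def sum_subtractf sum_laplacian_zero)
  ultimately show ?thesis using that g by blast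
qed

text \<open>After passing to an effective representative, only degrees of effective divisors have to
  be bounded from below.\<close>

lemma gonality_eqI:
  assumes G: "multigraph G"
    and D: "div_degree G D = int d" "0 < div_rank G D"
    and lower: "\<And>D. div_effective G D \<Longrightarrow> 0 < div_rank G D \<Longrightarrow> int d \<le> div_degree G D"
  shows "gonality G = d"
  unfolding gonality_def
proof (rule Least_equality)
  show "\<exists>D. div_degree G D = int d \<and> 0 < div_rank G D" using D by blast
next
  fix d' assume "\<exists>D. div_degree G D = int d' \<and> 0 < div_rank G D"
  then obtain D1 where D1: "div_degree G D1 = int d'" "0 < div_rank G D1" by blast
  from div_rank_pos_effective_representative[OF G D1(2)] lower
  have "int d \<le> div_degree G D1" by metis
  with D1 show "d \<le> d'" by simp
qed

section \<open>Firing across heavy edges\<close>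

text \<open>
  The superlevel set of f just above f b loses, across its boundary, at least one chip per copy
  of the edge from a to b.
\<close>

lemma firing_le_across_heavy_edge:
  assumes G: "multigraph G" and ab: "a \<in> mg_verts G" "b \<in> mg_verts G"
    and D: "div_effective G D" and D': "div_effective G (\<lambda>v. D v - mg_laplacian G f v)"
    and heavy: "div_degree G D < int (count (mg_edges G) {a, b})"
  shows "f a \<le> f b"
proof (rule ccontr)
  assume "\<not> f a \<le> f b"
  let ?V = "mg_verts G" and ?c = "\<lambda>u v. int (count (mg_edges G) {u, v})"
  have fin: "finite ?V" using G by (simp add: multigraph_def)
  define A where "A = {v\<in>?V. f b < f v}"
  have A: "A \<subseteq> ?V" "finite A" "a \<in> A" "b \<in> ?V - A"
    using fin ab \<open>\<not> f a \<le> f b\<close> by (auto simp: A_def)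
  \<comment> \<open>The heavy edge joins \<open>a\<close> in \<open>A\<close> to \<open>b\<close>
    outside, and \<open>f a - f b\<close> is at least 1.\<close>
  have "?c a b \<le> ?c b a * (f a - f b)"
    using \<open>\<not> f a \<le> f b\<close> by (simp add: insert_commute mult_le_cancel_left1)
  also have "\<dots> \<le> (\<Sum>u\<in>?V - A. ?c u a * (f a - f u))"
    using A fin by (intro member_le_sum) (auto simp: A_def)
  also have "\<dots> \<le> (\<Sum>v\<in>A. \<Sum>u\<in>?V - A. ?c u v * (f v - f u))"
    using A by (intro member_le_sum[where f = "\<lambda>v. \<Sum>u\<in>?V - A. ?c u v * (f v - f u)"] sum_nonneg)
      (auto simp: A_def)
  \<comment> \<open>Edges inside \<open>A\<close> contribute 0 in total; adding them completes the
    boundary sum to a sum of Laplacians.\<close>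
  also have "\<dots> = (\<Sum>v\<in>A. (\<Sum>u\<in>?V - A. ?c u v * (f v - f u)) + (\<Sum>u\<in>A. ?c u v * (f v - f u)))"
    by (simp add: sum.distrib sum_laplacian_inside_zero)
  also have "\<dots> = (\<Sum>v\<in>A. mg_laplacian G f v)"
    unfolding mg_laplacian_def by (intro sum.cong refl sum.subset_diff[symmetric] A fin)
  also have "\<dots> \<le> (\<Sum>v\<in>A. D v)"
    using D' A by (intro sum_mono) (auto simp: div_effective_def)
  also have "\<dots> \<le> div_degree G D"
    using D A fin unfolding div_degree_def div_effective_def by (intro sum_mono2) auto
  finally show False using heavy by simp
qed

lemma firing_eq_across_heavy_edge:
  assumes "multigraph G" "a \<in> mg_verts G" "b \<in> mg_verts G"
    and "div_effective G D" "div_effective G (\<lambda>v. D v - mg_laplacian G f v)"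
    and "div_degree G D < int (count (mg_edges G) {a, b})"
  shows "f a = f b"
  using firing_le_across_heavy_edge[of G a b D f] firing_le_across_heavy_edge[of G b a D f] assms
  by (simp add: insert_commute order_antisym)

section \<open>Multigraphs given by oriented edges\<close>

text \<open>Ordered pairs let a sum over edges name a tail and a head; the graph itself forgets the
  order.\<close>

definition multigraph_of :: "'v set \<Rightarrow> ('v \<times> 'v) multiset \<Rightarrow> 'v mgraph" where
  "multigraph_of V E = \<lparr>mg_verts = V, mg_edges = image_mset (\<lambda>(a, b). {a, b}) E\<rparr>"

lemma mg_verts_multigraph_of [simp]: "mg_verts (multigraph_of V E) = V"
  by (simp add: multigraph_of_def)

text \<open>Each edge \<open>(a, b)\<close> carries \<open>f a - f b\<close> chips from
  \<open>a\<close> to \<open>b\<close>, a loss at \<open>a\<close> and a gain at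
  \<open>b\<close>.\<close>

lemma mg_laplacian_multigraph_of:
  assumes "finite V" "\<And>a b. (a, b) \<in># E \<Longrightarrow> a \<in> V \<and> b \<in> V \<and> a \<noteq> b"
  shows "mg_laplacian (multigraph_of V E) f v =
    (\<Sum>(a, b)\<in>#E. (of_bool (a = v) - of_bool (b = v)) * (f a - f b))"
  using assms(2)
proof (induction E)
  case empty
  then show ?case by (simp add: mg_laplacian_def multigraph_of_def)
next
  case (add x E)
  obtain a b where x: "x = (a, b)" by force
  have ab: "a \<in> V" "b \<in> V" "a \<noteq> b" using add.prems[of a b] x by auto
  have "mg_laplacian (multigraph_of V (add_mset x E)) f v =
    mg_laplacian (multigraph_of V E) f v + (\<Sum>u\<in>V. of_bool ({a, b} = {u, v}) * (f v - f u))"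
    unfolding mg_laplacian_def x mg_verts_multigraph_of sum.distrib[symmetric]
    by (intro sum.cong refl) (simp add: multigraph_of_def algebra_simps)
  \<comment> \<open>Only \<open>u = a\<close> and \<open>u = b\<close> contribute, and
    \<open>a \<noteq> b\<close> keeps the two cases apart.\<close>
  also have "(\<Sum>u\<in>V. of_bool ({a, b} = {u, v}) * (f v - f u)) =
    (\<Sum>u\<in>V. if u = a then of_bool (b = v) * (f b - f a) 
      else if u = b then of_bool (a = v) * (f a - f b) else 0)"
    using ab by (intro sum.cong refl) (auto simp: doubleton_eq_iff)
  also have "\<dots> = (\<Sum>u\<in>V. (if u = a then of_bool (b = v) * (f b - f a) else 0) +
      (if u = b then of_bool (a = v) * (f a - f b) else 0))"
    using ab by (intro sum.cong refl) auto
  also have "\<dots> = (of_bool (a = v) - of_bool (b = v)) * (f a - f b)"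
    using ab assms(1) by (simp add: sum.distrib algebra_simps)
  finally have "mg_laplacian (multigraph_of V (add_mset x E)) f v =
    mg_laplacian (multigraph_of V E) f v +
    (of_bool (a = v) - of_bool (b = v)) * (f a - f b)" .
  moreover have "mg_laplacian (multigraph_of V E) f v =
    (\<Sum>(a, b)\<in>#E. (of_bool (a = v) - of_bool (b = v)) * (f a - f b))"
    using add.prems by (intro add.IH) auto
  ultimately show ?case by (simp add: x)
qed


lemma sum_mset_repeat_mset:
  fixes g :: "'a \<Rightarrow> int"
  shows "(\<Sum>x\<in>#repeat_mset n M. g x) = int n * (\<Sum>x\<in>#M. g x)"
  by (induction n) (simp_all add: algebra_simps)

lemma mem_repeat_mset: "x \<in># repeat_mset n M \<longleftrightarrow> 0 < n \<and> x \<in># M"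
  by (simp flip: count_greater_zero_iff)

section \<open>The example graphs\<close>

text \<open>
  The example consists of a path with r + 3 vertices and, at each of its two ends, of a star with
  r leaves, each leaf being tied to that end of the path by 2 r + 1 parallel edges. The centres of
  the stars (index 0) are joined by k edges, where k = 1 for G and k = 0 for G - e. The two stars
  are told apart by a boolean.
\<close>

definition path_vertex :: "nat \<Rightarrow> nat" where
  "path_vertex i = 3 * i"

definition star_vertex :: "bool \<Rightarrow> nat \<Rightarrow> nat" where
  "star_vertex s j = 3 * j + 1 + of_bool s"

text \<open>Decodes a vertex, so that divisors and firing scripts can be given by cases on path and
  stars.\<close>

definition vertex_rec :: "(nat \<Rightarrow> 'a) \<Rightarrow> (bool \<Rightarrow> nat \<Rightarrow> 'a) \<Rightarrow> nat \<Rightarrow> 'a" where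
  "vertex_rec g h w = (if w mod 3 = 0 then g (w div 3) else h (w mod 3 = 2) (w div 3))"

lemma vertex_rec_path [simp]: "vertex_rec g h (path_vertex i) = g i"
  by (simp add: vertex_rec_def path_vertex_def)

lemma vertex_rec_star [simp]: "vertex_rec g h (star_vertex s j) = h s j"
proof -
  have "star_vertex s j mod 3 = 1 + of_bool s" "star_vertex s j div 3 = j"
    by (cases s; simp add: star_vertex_def; presburger)+
  then show ?thesis by (cases s) (simp_all add: vertex_rec_def)
qed

lemma path_vertex_eq_iff [simp]: "path_vertex i = path_vertex j \<longleftrightarrow> i = j"
  by (simp add: path_vertex_def)

lemma star_vertex_eq_iff [simp]: "star_vertex s i = star_vertex t j \<longleftrightarrow> s = t \<and> i = j"
  by (cases s; cases t; simp add: star_vertex_def; presburger)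

lemma path_neq_star [simp]: "path_vertex i \<noteq> star_vertex s j" "star_vertex s j \<noteq> path_vertex i"
  by (cases s; simp add: path_vertex_def star_vertex_def; presburger)+

definition anchor :: "nat \<Rightarrow> bool \<Rightarrow> nat" where
  "anchor r s = (if s then r + 2 else 0)"

definition example_verts :: "nat \<Rightarrow> nat set" where
  "example_verts r = path_vertex ` {..r + 2} \<union> (star_vertex False ` {..r} \<union> star_vertex True ` {..r})"

text \<open>The multiplicity \<open>2 * r + 1\<close> exceeds every degree that the lower bound for
  \<open>k = 0\<close> has to exclude.\<close>

definition star_edges :: "nat \<Rightarrow> bool \<Rightarrow> (nat \<times> nat) multiset" where
  "star_edges r s =
     image_mset (\<lambda>j. (star_vertex s j, star_vertex s 0)) (mset_set {1..r}) +
     repeat_mset (2 * r + 1)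
       (image_mset (\<lambda>j. (path_vertex (anchor r s), star_vertex s j)) (mset_set {1..r}))"

text \<open>The path has \<open>r + 2\<close> edges to keep pace with the other route: one step from
  the leaves to the first centre, \<open>r\<close> steps for \<open>r\<close> chips to cross a
  single edge, one step out to the far leaves.\<close>

definition example_edges :: "nat \<Rightarrow> nat \<Rightarrow> (nat \<times> nat) multiset" where
  "example_edges r k =
     image_mset (\<lambda>i. (path_vertex i, path_vertex (Suc i))) (mset_set {..<r + 2}) +
     star_edges r False + star_edges r True +
     replicate_mset k (star_vertex False 0, star_vertex True 0)"

definition example :: "nat \<Rightarrow> nat \<Rightarrow> nat mgraph" where
  "example r k = multigraph_of (example_verts r) (example_edges r k)"

lemma mg_verts_example [simp]: "mg_verts (example r k) = example_verts r"
  by (simp add: example_def)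

lemma finite_example_verts [simp]: "finite (example_verts r)"
  by (simp add: example_verts_def)

lemma path_vertex_in_example [simp]: "path_vertex i \<in> example_verts r \<longleftrightarrow> i \<le> r + 2"
  by (auto simp: example_verts_def)

lemma star_vertex_in_example [simp]: "star_vertex s j \<in> example_verts r \<longleftrightarrow> j \<le> r"
  by (cases s) (auto simp: example_verts_def)

lemma example_vertsE:
  assumes "v \<in> example_verts r"
  obtains (path) i where "v = path_vertex i" "i \<le> r + 2"
  | (centre) s where "v = star_vertex s 0"
  | (leaf) s j where "v = star_vertex s j" "1 \<le> j" "j \<le> r"
proof -
  consider i where "v = path_vertex i" "i \<le> r + 2" | s j where "v = star_vertex s j" "j \<le> r"
    using assms by (auto simp: example_verts_def)
  then show ?thesis
  proof cases
    case (2 s j)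
    then show ?thesis using that by (cases "j = 0") auto
  qed (rule that)
qed

lemma sum_example_verts:
  fixes g :: "nat \<Rightarrow> int"
  shows "(\<Sum>v\<in>example_verts r. g v) = (\<Sum>i\<le>r + 2. g (path_vertex i)) +
    (g (star_vertex False 0) + (\<Sum>j=1..r. g (star_vertex False j))) +
    (g (star_vertex True 0) + (\<Sum>j=1..r. g (star_vertex True j)))"
proof -
  have split: "(\<Sum>j\<le>r. h j) = h 0 + (\<Sum>j=1..r. h j)" for h :: "nat \<Rightarrow> int"
    by (simp add: atMost_atLeast0 sum.atLeast_Suc_atMost)
  have "inj path_vertex" "inj (star_vertex s)" for s by (simp_all add: inj_def)
  then have inj: "inj_on path_vertex A" "inj_on (star_vertex s) A" for s A
    by (auto intro: inj_on_subset)
  have "(\<Sum>v\<in>example_verts r. g v) = (\<Sum>v\<in>path_vertex ` {..r + 2}. g v) +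
    ((\<Sum>v\<in>star_vertex False ` {..r}. g v) + (\<Sum>v\<in>star_vertex True ` {..r}. g v))"
    unfolding example_verts_def by (subst sum.union_disjoint, auto)+
  then show ?thesis by (simp add: sum.reindex inj split)
qed

lemma example_edges_in_verts:
  assumes "(a, b) \<in># example_edges r k"
  shows "a \<in> example_verts r \<and> b \<in> example_verts r \<and> a \<noteq> b"
  using assms
  by (auto simp: example_edges_def star_edges_def anchor_def mem_repeat_mset
      simp del: repeat_mset_Suc split: if_splits)

lemma multigraph_example: "multigraph (example r k)"
proof -
  have "path_vertex 0 \<in> example_verts r" by simp
  then have "example_verts r \<noteq> {}" by blast
  moreover have "{a, b} \<subseteq> example_verts r \<and> card {a, b} = 2" if "(a, b) \<in># example_edges r k" for a b
    using example_edges_in_verts[OF that] by simp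
  ultimately show ?thesis
    unfolding multigraph_def by (auto simp: example_def multigraph_of_def)
qed

lemma mg_adj_exampleI:
  assumes "(a, b) \<in># example_edges r k"
  shows "mg_adj (example r k) a b"
  using imageI[OF assms, of "\<lambda>(a, b). {a, b}"]
  by (simp add: mg_adj_def example_def multigraph_of_def)

lemma mg_adj_example:
  "i < r + 2 \<Longrightarrow> mg_adj (example r k) (path_vertex i) (path_vertex (Suc i))"
  "1 \<le> j \<Longrightarrow> j \<le> r \<Longrightarrow> mg_adj (example r k) (path_vertex (anchor r s)) (star_vertex s j)"
  "1 \<le> j \<Longrightarrow> j \<le> r \<Longrightarrow> mg_adj (example r k) (star_vertex s j) (star_vertex s 0)"
proof -
  assume "i < r + 2"
  then show "mg_adj (example r k) (path_vertex i) (path_vertex (Suc i))"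
    by (intro mg_adj_exampleI) (auto simp: example_edges_def)
next
  assume "1 \<le> j" "j \<le> r"
  then have "(path_vertex (anchor r s), star_vertex s j) \<in># star_edges r s"
    "(star_vertex s j, star_vertex s 0) \<in># star_edges r s"
    by (auto simp: star_edges_def mem_repeat_mset simp del: repeat_mset_Suc)
  then show "mg_adj (example r k) (path_vertex (anchor r s)) (star_vertex s j)"
    "mg_adj (example r k) (star_vertex s j) (star_vertex s 0)"
    by (cases s; auto intro!: mg_adj_exampleI simp: example_edges_def)+
qed

text \<open>Path and star edges already connect everything, so \<open>k = 0\<close> is covered too.
  Each centre is reached through leaf 1, which exists as \<open>1 \<le> r\<close>.\<close>

lemma mg_connected_example:
  assumes "1 \<le> r"
  shows "mg_connected (example r k)"
proof -
  let ?R = "(mg_adj (example r k))\<^sup>*\<^sup>*"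
  have path: "?R (path_vertex 0) (path_vertex i)" if "i \<le> r + 2" for i
    using that
  proof (induction i)
    case (Suc i)
    then have "?R (path_vertex 0) (path_vertex i)" by simp
    moreover have "mg_adj (example r k) (path_vertex i) (path_vertex (Suc i))"
      using Suc.prems by (intro mg_adj_example(1)) simp
    ultimately show ?case by (rule rtranclp.rtrancl_into_rtrancl)
  qed simp
  have leaf: "?R (path_vertex 0) (star_vertex s j)" if "1 \<le> j" "j \<le> r" for s j
  proof (rule rtranclp.rtrancl_into_rtrancl)
    show "?R (path_vertex 0) (path_vertex (anchor r s))" by (rule path) (simp add: anchor_def)
  qed (rule mg_adj_example(2)[OF that])
  have centre: "?R (path_vertex 0) (star_vertex s 0)" for s
    using leaf[of 1 s] mg_adj_example(3)[of 1 r k s] assms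
    by (auto intro: rtranclp.rtrancl_into_rtrancl)
  have from0: "?R (path_vertex 0) v" if "v \<in> example_verts r" for v
    using that by (cases rule: example_vertsE) (auto intro: path leaf centre)
  have "symp ?R"
    by (intro symp_rtranclp sympI) (simp add: mg_adj_def insert_commute)
  then show ?thesis
    unfolding mg_connected_def using from0 by (auto dest: sympD intro: rtranclp_trans)
qed

lemma mg_delete_edge_example:
  "mg_delete_edge (example r 1) {star_vertex False 0, star_vertex True 0} = example r 0"
  by (simp add: mg_delete_edge_def example_def multigraph_of_def example_edges_def)

section \<open>The Laplacian of the example\<close>

text \<open>These are the scripts that heavy edges permit in low degree: each leaf is fired as often
  as the path end it is tied to.\<close>

definition clustered :: "nat \<Rightarrow> (nat \<Rightarrow> int) \<Rightarrow> bool" where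
  "clustered r f \<longleftrightarrow>
     (\<forall>s. \<forall>j\<in>{1..r}. f (star_vertex s j) = f (path_vertex (anchor r s)))"

text \<open>Heavy edges drop out because \<open>f\<close> agrees at their ends, and in the star
  edges the value at a leaf becomes the value at the anchor.\<close>

lemma mg_laplacian_example:
  assumes "clustered r f"
  shows "mg_laplacian (example r k) f v =
    (\<Sum>i<r + 2. (of_bool (path_vertex i = v) - of_bool (path_vertex (Suc i) = v)) *
        (f (path_vertex i) - f (path_vertex (Suc i)))) +
    (\<Sum>s\<in>UNIV. (\<Sum>j=1..r. of_bool (star_vertex s j = v) - of_bool (star_vertex s 0 = v)) *
        (f (path_vertex (anchor r s)) - f (star_vertex s 0))) +
    int k * (of_bool (star_vertex False 0 = v) - of_bool (star_vertex True 0 = v)) *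
        (f (star_vertex False 0) - f (star_vertex True 0))"
proof -
  have "(\<Sum>(a, b)\<in>#star_edges r s. (of_bool (a = v) - of_bool (b = v)) * (f a - f b)) =
    (\<Sum>j=1..r. of_bool (star_vertex s j = v) - of_bool (star_vertex s 0 = v)) *
        (f (path_vertex (anchor r s)) - f (star_vertex s 0))" for s
  proof -
    have eq: "f (star_vertex s j) = f (path_vertex (anchor r s))" if "j \<in> {1..r}" for j
      using assms that by (auto simp: clustered_def)
    show ?thesis
      unfolding star_edges_def
      by (simp add: sum_mset_repeat_mset image_mset.compositionality comp_def
          sum_unfold_sum_mset[symmetric] eq sum_distrib_right del: repeat_mset_Suc)
  qed
  moreover have "mg_laplacian (example r k) f v =
    (\<Sum>(a, b)\<in>#example_edges r k. (of_bool (a = v) - of_bool (b = v)) * (f a - f b))"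
    unfolding example_def
    by (rule mg_laplacian_multigraph_of[OF finite_example_verts example_edges_in_verts])
  ultimately show ?thesis
    by (simp add: example_edges_def image_mset.compositionality comp_def
        sum_unfold_sum_mset[symmetric] UNIV_bool)
qed

lemma mg_laplacian_example_path:
  assumes "clustered r f" "i \<le> r + 2"
  shows "mg_laplacian (example r k) f (path_vertex i) =
    (if i < r + 2 then f (path_vertex i) - f (path_vertex (Suc i)) else 0) +
    (if 0 < i then f (path_vertex i) - f (path_vertex (i - 1)) else 0)"
proof -
  let ?d = "\<lambda>i. f (path_vertex i) - f (path_vertex (Suc i))"
  have "mg_laplacian (example r k) f (path_vertex i) =
    (\<Sum>i'<r + 2. (of_bool (i' = i) - of_bool (Suc i' = i)) * ?d i')"
    using assms by (simp add: mg_laplacian_example)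
  also have "\<dots> = (\<Sum>i'<r + 2. if i' = i then ?d i' else 0) - (\<Sum>i'<r + 2. if Suc i' = i then ?d i' else 0)"
    unfolding sum_subtractf[symmetric] by (intro sum.cong refl) auto
  also have "(\<Sum>i'<r + 2. if i' = i then ?d i' else 0) = (if i < r + 2 then ?d i else 0)"
    by (simp del: sum.lessThan_Suc)
  also have "(\<Sum>i'<r + 2. if Suc i' = i then ?d i' else 0) = (if 0 < i then ?d (i - 1) else 0)"
    using assms(2) by (cases i) (simp_all del: sum.lessThan_Suc)
  finally show ?thesis by auto
qed

lemma mg_laplacian_example_leaf:
  assumes "clustered r f" "1 \<le> j" "j \<le> r"
  shows "mg_laplacian (example r k) f (star_vertex s j) =
    f (path_vertex (anchor r s)) - f (star_vertex s 0)"
proof -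
  have "(\<Sum>j'=1..r. of_bool (j' = j)) = (1::int)"
    using assms by (simp add: of_bool_def)
  then show ?thesis
    using assms by (cases s) (simp_all add: mg_laplacian_example UNIV_bool)
qed

lemma mg_laplacian_example_centre:
  assumes "clustered r f"
  shows "mg_laplacian (example r k) f (star_vertex s 0) =
    int r * (f (star_vertex s 0) - f (path_vertex (anchor r s))) +
    int k * (f (star_vertex s 0) - f (star_vertex (\<not> s) 0))"
proof -
  have "(\<Sum>j=1..r. of_bool (j = 0) - 1) = - int r"
    by simp
  then show ?thesis
    using assms by (cases s) (simp_all add: mg_laplacian_example UNIV_bool algebra_simps)
qed

text \<open>The path is attached to the rest only by heavy edges, which carry no chips; what remains
  telescopes.\<close>

lemma sum_mg_laplacian_example_path:
  assumes "clustered r f"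
  shows "(\<Sum>i\<le>r + 2. mg_laplacian (example r k) f (path_vertex i)) = 0"
proof -
  define p where "p i = f (path_vertex i)" for i
  have "(\<Sum>i\<le>n. (if i < n then p i - p (Suc i) else 0) + (if 0 < i then p i - p (i - 1) else 0)) = 0"
    for n
  proof -
    have "(\<Sum>i\<le>n. if i < n then p i - p (Suc i) else 0) = (\<Sum>i<n. p i - p (Suc i))"
      by (simp add: lessThan_Suc_atMost[symmetric])
    moreover have "(\<Sum>i\<le>n. if 0 < i then p i - p (i - 1) else 0) = (\<Sum>i<n. p (Suc i) - p i)"
      by (simp add: sum.atMost_shift)
    ultimately show ?thesis
      by (simp add: sum.distrib sum_subtractf)
  qed
  moreover have "(\<Sum>i\<le>r + 2. mg_laplacian (example r k) f (path_vertex i)) =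
    (\<Sum>i\<le>r + 2. (if i < r + 2 then p i - p (Suc i) else 0) + (if 0 < i then p i - p (i - 1) else 0))"
    unfolding p_def using assms by (intro sum.cong refl mg_laplacian_example_path) simp_all
  ultimately show ?thesis by simp
qed

definition star_degree :: "nat \<Rightarrow> bool \<Rightarrow> (nat \<Rightarrow> int) \<Rightarrow> int" where
  "star_degree r s D = D (star_vertex s 0) + (\<Sum>j=1..r. D (star_vertex s j))"

lemma star_degree_diff:
  "star_degree r s (\<lambda>v. D v - D' v) = star_degree r s D - star_degree r s D'"
  by (simp add: star_degree_def sum_subtractf)

text \<open>What the leaves send to their centre stays in the star, so chips leave it only over the
  \<open>k\<close> edges between the centres.\<close>

lemma star_degree_mg_laplacian_example:
  assumes "clustered r f"
  shows "star_degree r s (mg_laplacian (example r k) f) =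
    int k * (f (star_vertex s 0) - f (star_vertex (\<not> s) 0))"
  using assms
  by (simp add: star_degree_def mg_laplacian_example_leaf mg_laplacian_example_centre algebra_simps)

lemma div_degree_example:
  "div_degree (example r k) D =
    (\<Sum>i\<le>r + 2. D (path_vertex i)) + star_degree r False D + star_degree r True D"
  by (simp add: div_degree_def sum_example_verts star_degree_def del: sum.atMost_Suc add_2_eq_Suc')

lemma star_degree_nonneg:
  assumes "div_effective (example r k) D"
  shows "0 \<le> star_degree r s D"
  using assms by (auto simp: div_effective_def star_degree_def intro!: add_nonneg_nonneg sum_nonneg)

section \<open>Lower bounds on the degree\<close>

lemma count_heavy_edge:
  assumes "1 \<le> j" "j \<le> r"
  shows "2 * r + 1 \<le> count (mg_edges (example r k)) {path_vertex (anchor r s), star_vertex s j}"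
proof -
  let ?x = "(path_vertex (anchor r s), star_vertex s j)"
  let ?M = "image_mset (\<lambda>j. (path_vertex (anchor r s), star_vertex s j)) (mset_set {1..r})"
  have "?x \<in># ?M" using assms by auto
  then have "1 \<le> count ?M ?x" by (simp add: Suc_le_eq del: count_image_mset)
  then have "(2 * r + 1) * 1 \<le> (2 * r + 1) * count ?M ?x" by (rule mult_le_mono2)
  also have "\<dots> \<le> count (star_edges r s) ?x"
    unfolding star_edges_def count_union count_repeat_mset by (rule le_add2)
  also have "\<dots> \<le> count (example_edges r k) ?x"
    unfolding example_edges_def by (cases s) simp_all
  \<comment> \<open>A block of equal pairs maps to a block of equal unordered edges, so the bound
    survives forgetting the orientation.\<close>
  finally have "replicate_mset (2 * r + 1) ?x \<subseteq># example_edges r k"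
    by (simp only: count_le_replicate_mset_subset_eq mult_1_right)
  from image_mset_subseteq_mono[OF this, of "\<lambda>(a, b). {a, b}"]
  have "replicate_mset (2 * r + 1) {path_vertex (anchor r s), star_vertex s j}
      \<subseteq># mg_edges (example r k)"
    by (simp only: example_def multigraph_of_def mgraph.simps image_replicate_mset prod.case)
  then show ?thesis
    by (simp only: count_le_replicate_mset_subset_eq)
qed

text \<open>The degree is below the multiplicity of each heavy edge, so the script cannot separate
  its ends.\<close>

lemma clustered_if_small_degree:
  assumes D: "div_effective (example r k) D" "div_degree (example r k) D < 2 * int r + 1"
    and D': "div_effective (example r k) (\<lambda>v. D v - mg_laplacian (example r k) f v)"
  shows "clustered r f"
  unfolding clustered_def
proof (intro allI ballI)
  fix s j assume j: "j \<in> {1..r}"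
  have "div_degree (example r k) D <
      int (count (mg_edges (example r k)) {path_vertex (anchor r s), star_vertex s j})"
    using D(2) count_heavy_edge[of j r k s] j by simp
  then have "f (path_vertex (anchor r s)) = f (star_vertex s j)"
    using j by (intro firing_eq_across_heavy_edge[OF multigraph_example _ _ D(1) D'])
      (auto simp: anchor_def)
  then show "f (star_vertex s j) = f (path_vertex (anchor r s))" ..
qed

text \<open>The script that brings a chip to \<open>path_vertex 0\<close> is clustered and hence
  keeps the number of chips on the path.\<close>

lemma path_degree_ge_one:
  assumes D: "div_effective (example r k) D" "div_degree (example r k) D < 2 * int r + 1"
    and rank: "0 < div_rank (example r k) D"
  shows "1 \<le> (\<Sum>i\<le>r + 2. D (path_vertex i))"
proof -
  let ?G = "example r k"
  obtain f where f: "div_effective ?G (\<lambda>v. D v - mg_laplacian ?G f v)"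
      "1 \<le> D (path_vertex 0) - mg_laplacian ?G f (path_vertex 0)"
    using rank div_rank_pos_iff[OF multigraph_example] by fastforce
  have "(\<Sum>i\<le>r + 2. D (path_vertex i)) =
      (\<Sum>i\<le>r + 2. D (path_vertex i) - mg_laplacian ?G f (path_vertex i))"
    unfolding sum_subtractf
    using sum_mg_laplacian_example_path[OF clustered_if_small_degree[OF D f(1)], of k] by simp
  also have "\<dots> \<ge> D (path_vertex 0) - mg_laplacian ?G f (path_vertex 0)"
    using f(1) by (intro member_le_sum) (auto simp: div_effective_def)
  finally show ?thesis using f(2) by linarith
qed

text \<open>
  All leaves of a star gain the same number of chips, so a chip on an initially empty leaf
  means a chip on every leaf.
\<close>

lemma all_leaves_occupied:
  assumes D: "div_effective (example r k) D" "div_degree (example r k) D < 2 * int r + 1"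
    and rank: "0 < div_rank (example r k) D"
  obtains f where "clustered r f"
    "div_effective (example r k) (\<lambda>v. D v - mg_laplacian (example r k) f v)"
    "int r \<le> star_degree r s (\<lambda>v. D v - mg_laplacian (example r k) f v)"
proof -
  let ?G = "example r k"
  have "\<exists>f. div_effective ?G (\<lambda>v. D v - mg_laplacian ?G f v) \<and>
      (\<forall>j\<in>{1..r}. 1 \<le> D (star_vertex s j) - mg_laplacian ?G f (star_vertex s j))"
  proof (cases "\<exists>j\<in>{1..r}. D (star_vertex s j) \<le> 0")
    \<comment> \<open>Every leaf is occupied from the start, and the zero script serves.\<close>
    case False
    then show ?thesis
      using D(1) by (intro exI[of _ "\<lambda>_. 0"]) (auto simp: mg_laplacian_def)
  next
    case True
    then obtain j where j: "j \<in> {1..r}" "D (star_vertex s j) \<le> 0" by blast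
    then obtain f where f: "div_effective ?G (\<lambda>v. D v - mg_laplacian ?G f v)"
        "1 \<le> D (star_vertex s j) - mg_laplacian ?G f (star_vertex s j)"
      using rank div_rank_pos_iff[OF multigraph_example] by fastforce
    have cl: "clustered r f" using clustered_if_small_degree[OF D f(1)] .
    have "1 \<le> D (star_vertex s i) - mg_laplacian ?G f (star_vertex s i)" if "i \<in> {1..r}" for i
    proof -
      have "0 \<le> D (star_vertex s i)" using D(1) that by (simp add: div_effective_def)
      then show ?thesis
        using f(2) j that by (simp add: mg_laplacian_example_leaf[OF cl])
    qed
    then show ?thesis using f(1) by blast
  qed
  then obtain f where f: "div_effective ?G (\<lambda>v. D v - mg_laplacian ?G f v)"
      "\<And>j. j \<in> {1..r} \<Longrightarrow> 1 \<le> D (star_vertex s j) - mg_laplacian ?G f (star_vertex s j)"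
    by blast
  have "(\<Sum>j=1..r. 1) \<le> (\<Sum>j=1..r. D (star_vertex s j) - mg_laplacian ?G f (star_vertex s j))"
    by (rule sum_mono) (rule f(2))
  moreover have "0 \<le> D (star_vertex s 0) - mg_laplacian ?G f (star_vertex s 0)"
    using f(1) by (simp add: div_effective_def)
  ultimately have "int r \<le> star_degree r s (\<lambda>v. D v - mg_laplacian ?G f v)"
    by (simp add: star_degree_def)
  then show ?thesis using that clustered_if_small_degree[OF D f(1)] f(1) by blast
qed

text \<open>What leaves one star over the centre edges enters the other, so the stars together keep
  their chips. Filling the leaves of one star takes \<open>r\<close> of them, and the path holds one
  more.\<close>

lemma div_degree_example_ge:
  assumes D: "div_effective (example r k) D" and rank: "0 < div_rank (example r k) D"
  shows "int r + 1 \<le> div_degree (example r k) D"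
proof (rule ccontr)
  assume contra: "\<not> ?thesis"
  then have small: "div_degree (example r k) D < 2 * int r + 1" by simp
  let ?D = "\<lambda>f v. D v - mg_laplacian (example r k) f v"
  obtain f where f: "clustered r f" "div_effective (example r k) (?D f)"
      "int r \<le> star_degree r False (?D f)"
    using all_leaves_occupied[OF D small rank] .
  have "star_degree r False (?D f) + star_degree r True (?D f) =
      star_degree r False D + star_degree r True D"
    by (simp add: star_degree_diff star_degree_mg_laplacian_example[OF f(1)] algebra_simps)
  then show False
    using f(3) star_degree_nonneg[OF f(2), of True] path_degree_ge_one[OF D small rank] contra
    unfolding div_degree_example by linarith
qed

text \<open>With no edge between the centres each star conserves its own chips, so the
  \<open>r\<close> chips that can occupy its leaves are on it in \<open>D\<close> already.\<close>

lemma div_degree_example_without_edge_ge: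
  assumes D: "div_effective (example r 0) D" and rank: "0 < div_rank (example r 0) D"
  shows "2 * int r + 1 \<le> div_degree (example r 0) D"
proof (rule ccontr)
  assume contra: "\<not> ?thesis"
  then have small: "div_degree (example r 0) D < 2 * int r + 1" by simp
  have "int r \<le> star_degree r s D" for s
  proof -
    obtain f where "clustered r f"
        "int r \<le> star_degree r s (\<lambda>v. D v - mg_laplacian (example r 0) f v)"
      using all_leaves_occupied[OF D small rank] .
    then show ?thesis
      by (simp add: star_degree_diff star_degree_mg_laplacian_example)
  qed
  from this[of False] this[of True] show False
    using path_degree_ge_one[OF D small rank] small unfolding div_degree_example by linarith
qed

section \<open>Divisors attaining the bounds\<close>

text \<open>
  After t firings the chips form the t-th level of a map of degree r + 1 from G to a path with
  r + 3 vertices, which has expansion factor r along the edge between the two centres. The chip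
  counts use truncated subtraction.
\<close>

lemma gonality_example_with_edge:
  assumes "1 \<le> r"
  shows "gonality (example r 1) = r + 1"
proof (rule gonality_eqI[OF multigraph_example])
  let ?G = "example r 1"
  define D :: "nat \<Rightarrow> int" where
    "D = vertex_rec (\<lambda>i. of_bool (i = 0)) (\<lambda>s j. of_bool (\<not> s \<and> 0 < j))"
  \<comment> \<open>The value is \<open>t\<close> minus the level of the vertex, truncated at 0.
    Levels are \<open>i\<close> on the path, 0 and 1 at the leaves and centre of the first star,
    \<open>r + 1\<close> and \<open>r + 2\<close> at the centre and leaves of the second. The
    constant 0 at the far leaves fits \<open>t \<le> r + 2\<close>.\<close>
  define f where "f t = vertex_rec (\<lambda>i. int (t - i))
    (\<lambda>s j. if s then (if j = 0 then int (t - 1 - r) else 0) else (if j = 0 then int (t - 1) else int t))"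
    for t
  have f: "f t (path_vertex i) = int (t - i)"
    "f t (star_vertex s j) =
      (if s then (if j = 0 then int (t - 1 - r) else 0) else (if j = 0 then int (t - 1) else int t))"
    for t i s j by (simp_all add: f_def)
  have "(\<Sum>i\<le>r + 2. of_bool (i = 0)) = (1 :: int)"
    by (simp add: of_bool_def del: sum.atMost_Suc add_2_eq_Suc')
  then show "div_degree ?G D = int (r + 1)"
    unfolding div_degree_example star_degree_def by (simp add: D_def)
  \<comment> \<open>For \<open>1 \<le> t \<le> r + 1\<close>, \<open>t - 1\<close> of the
    \<open>r\<close> star chips have crossed between the centres; at \<open>t = 0\<close> and
    \<open>t = r + 2\<close> all of them sit on leaves.\<close>
  have level: "i \<le> r + 2 \<Longrightarrow> D (path_vertex i) - mg_laplacian ?G (f t) (path_vertex i) = of_bool (i = t)"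
      "D (star_vertex s 0) - mg_laplacian ?G (f t) (star_vertex s 0) =
        (if t = 0 \<or> t = r + 2 then 0 else if s then int (t - 1) else int (r + 1 - t))"
      "1 \<le> j \<Longrightarrow> j \<le> r \<Longrightarrow> D (star_vertex s j) - mg_laplacian ?G (f t) (star_vertex s j) =
        of_bool (t = anchor r s)"
    if t: "t \<le> r + 2" for t i s j
  proof -
    have cl: "clustered r (f t)" using t by (auto simp: clustered_def f anchor_def)
    show "D (path_vertex i) - mg_laplacian ?G (f t) (path_vertex i) = of_bool (i = t)"
      if "i \<le> r + 2"
      using that t by (auto simp: mg_laplacian_example_path[OF cl] D_def f)
    show "D (star_vertex s 0) - mg_laplacian ?G (f t) (star_vertex s 0) =
        (if t = 0 \<or> t = r + 2 then 0 else if s then int (t - 1) else int (r + 1 - t))"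
    proof -
      consider "t = 0" | "1 \<le> t" "t \<le> r + 1" | "t = r + 2" using t by linarith
      then show ?thesis
        unfolding mg_laplacian_example_centre[OF cl]
        by cases (auto simp: D_def f anchor_def of_nat_diff algebra_simps)
    qed
    show "D (star_vertex s j) - mg_laplacian ?G (f t) (star_vertex s j) = of_bool (t = anchor r s)"
      if "1 \<le> j" "j \<le> r"
      using that t by (auto simp: mg_laplacian_example_leaf[OF cl] D_def f anchor_def)
  qed
  have eff: "div_effective ?G (\<lambda>v. D v - mg_laplacian ?G (f t) v)" if "t \<le> r + 2" for t
    unfolding div_effective_def
  proof
    fix v assume "v \<in> mg_verts ?G"
    then have "v \<in> example_verts r" by simp
    then show "0 \<le> D v - mg_laplacian ?G (f t) v"
      using that by (cases rule: example_vertsE) (simp_all add: level del: One_nat_def)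
  qed
  have "\<exists>t\<le>r + 2. 1 \<le> D v - mg_laplacian ?G (f t) v" if "v \<in> example_verts r" for v
    using that
  proof (cases rule: example_vertsE)
    case (path i)
    then show ?thesis by (intro exI[of _ i]) (simp add: level del: One_nat_def)
  next
    case (centre s)
    then show ?thesis
      \<comment> \<open>All \<open>r\<close> star chips are at the first centre for
        \<open>t = 1\<close> and at the second for \<open>t = r + 1\<close>;
        \<open>1 \<le> r\<close> makes this at least one chip.\<close>
      using assms by (intro exI[of _ "if s then r + 1 else 1"]) (simp add: level del: One_nat_def)
  next
    case (leaf s j)
    then show ?thesis by (intro exI[of _ "anchor r s"]) (simp add: level anchor_def del: One_nat_def)
  qed
  then show "0 < div_rank ?G D"
    unfolding div_rank_pos_iff[OF multigraph_example] mg_verts_example using eff by blast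
qed (use div_degree_example_ge[of r] in \<open>simp add: add.commute\<close>)

text \<open>Each star has \<open>r\<close> chips of its own, on its leaves or at its centre, and one
  further chip walks along the path.\<close>

lemma gonality_example_without_edge:
  assumes "1 \<le> r"
  shows "gonality (example r 0) = 2 * r + 1"
proof (rule gonality_eqI[OF multigraph_example])
  let ?G = "example r 0"
  define D :: "nat \<Rightarrow> int" where
    "D = vertex_rec (\<lambda>i. of_bool (i = 0)) (\<lambda>s j. of_bool (0 < j))"
  have "(\<Sum>i\<le>r + 2. of_bool (i = 0)) = (1 :: int)"
    by (simp add: of_bool_def del: sum.atMost_Suc add_2_eq_Suc')
  then show "div_degree ?G D = int (2 * r + 1)"
    unfolding div_degree_example star_degree_def by (simp add: D_def)
  have along_path: "\<exists>f. div_effective ?G (\<lambda>v. D v - mg_laplacian ?G f v) \<and>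
      1 \<le> D (path_vertex t) - mg_laplacian ?G f (path_vertex t) \<and>
      (\<forall>s. \<forall>j\<in>{1..r}. 1 \<le> D (star_vertex s j) - mg_laplacian ?G f (star_vertex s j))"
    if t: "t \<le> r + 2" for t
  proof -
    \<comment> \<open>Each star is fired as a block with its end of the path, so its leaves stay
      occupied while the path chip moves to position \<open>t\<close>.\<close>
    define f where "f = vertex_rec (\<lambda>i. int (t - i)) (\<lambda>s j. if s then 0 else int t)"
    have f: "f (path_vertex i) = int (t - i)" "f (star_vertex s j) = (if s then 0 else int t)"
      for i s j by (simp_all add: f_def)
    have cl: "clustered r f" using t by (auto simp: clustered_def f anchor_def)
    have path: "D (path_vertex i) - mg_laplacian ?G f (path_vertex i) = of_bool (i = t)"
      if "i \<le> r + 2" for i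
      using that t by (auto simp: mg_laplacian_example_path[OF cl] D_def f)
    have centre: "D (star_vertex s 0) - mg_laplacian ?G f (star_vertex s 0) = 0" for s
      using t by (auto simp: mg_laplacian_example_centre[OF cl] D_def f anchor_def)
    have leaf: "D (star_vertex s j) - mg_laplacian ?G f (star_vertex s j) = 1"
      if "1 \<le> j" "j \<le> r" for s j
      using that t by (auto simp: mg_laplacian_example_leaf[OF cl] D_def f anchor_def)
    have "0 \<le> D v - mg_laplacian ?G f v" if "v \<in> example_verts r" for v
      using that by (cases rule: example_vertsE) (simp_all add: path centre leaf)
    then show ?thesis
      using t by (intro exI[of _ f]) (simp add: div_effective_def path leaf)
  qed
  have to_centre: "\<exists>f. div_effective ?G (\<lambda>v. D v - mg_laplacian ?G f v) \<and>
      1 \<le> D (star_vertex s 0) - mg_laplacian ?G f (star_vertex s 0)" for s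
  proof -
    \<comment> \<open>The centre of star \<open>s\<close> borrows once, drawing one chip from each
      of its \<open>r\<close> leaves.\<close>
    define f :: "nat \<Rightarrow> int" where
      "f = vertex_rec (\<lambda>i. 0) (\<lambda>s' j. if s' = s \<and> j = 0 then - 1 else 0)"
    have f: "f (path_vertex i) = 0"
      "f (star_vertex s' j) = (if s' = s \<and> j = 0 then - 1 else 0)"
      for i s' j by (simp_all add: f_def)
    have cl: "clustered r f" by (auto simp: clustered_def f)
    have path: "D (path_vertex i) - mg_laplacian ?G f (path_vertex i) = of_bool (i = 0)"
      if "i \<le> r + 2" for i
      using that by (simp add: mg_laplacian_example_path[OF cl] D_def f)
    have centre: "D (star_vertex s' 0) - mg_laplacian ?G f (star_vertex s' 0) =
        (if s' = s then int r else 0)" for s'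
      by (simp add: mg_laplacian_example_centre[OF cl] D_def f)
    have leaf: "D (star_vertex s' j) - mg_laplacian ?G f (star_vertex s' j) = of_bool (s' \<noteq> s)"
      if "1 \<le> j" "j \<le> r" for s' j
      using that by (simp add: mg_laplacian_example_leaf[OF cl] D_def f)
    have "0 \<le> D v - mg_laplacian ?G f v" if "v \<in> example_verts r" for v
      using that by (cases rule: example_vertsE) (simp_all add: path centre leaf)
    then show ?thesis
      using assms by (intro exI[of _ f]) (simp add: div_effective_def centre)
  qed
  show "0 < div_rank ?G D"
    unfolding div_rank_pos_iff[OF multigraph_example] mg_verts_example
  proof
    fix v assume "v \<in> example_verts r"
    then show "\<exists>f. div_effective ?G (\<lambda>w. D w - mg_laplacian ?G f w) \<and>
        1 \<le> D v - mg_laplacian ?G f v"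
    proof (cases rule: example_vertsE)
      case (path i)
      then show ?thesis using along_path[of i] by blast
    next
      case (centre s)
      then show ?thesis using to_centre[of s] by blast
    next
      case (leaf s j)
      then show ?thesis using along_path[of 0] by fastforce
    qed
  qed
qed (use div_degree_example_without_edge_ge[of r] in \<open>simp add: add.commute\<close>)

theorem theorem1p2:
  fixes r :: nat
  assumes "r \<ge> 1"
  shows "\<exists>(G :: nat mgraph) e.
           multigraph G \<and> mg_connected G \<and>
           e \<in># mg_edges G \<and> mg_connected (mg_delete_edge G e) \<and>
           gonality (mg_delete_edge G e) = gonality G + r"
proof (intro exI conjI)
  let ?e = "{star_vertex False 0, star_vertex True 0}"
  show "multigraph (example r 1)" by (rule multigraph_example)
  show "mg_connected (example r 1)" using assms by (rule mg_connected_example)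
  show "?e \<in># mg_edges (example r 1)"
    by (simp add: example_def multigraph_of_def example_edges_def)
  show "mg_connected (mg_delete_edge (example r 1) ?e)"
    unfolding mg_delete_edge_example using assms by (rule mg_connected_example)
  show "gonality (mg_delete_edge (example r 1) ?e) = gonality (example r 1) + r"
    unfolding mg_delete_edge_example gonality_example_with_edge[OF assms]
      gonality_example_without_edge[OF assms] by simp
qed

end
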